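(* $(\mathbb{H}^n,d)$ has finite intersection dimension with respect to itself: there exist $\kappa\in\mathbb{N}$ and $R>1$ such that whenever $t(1),\dots,t(\kappa)\ge1$, $r(1),\dots,r(\kappa)$ satisfy $r(i)\ge t(1)\cdots t(i)R$ for each $i$, and $x_1,\dots,x_\kappa\in\mathbb{H}^n$ satisfy $x_i\in\bigcap_{j<i}\partial_{t(j)}B_{r(j)}(x_j)$ for all $i\le\kappa$, we have $\bigcap_{i=1}^\kappa\partial_{t(i)}B_{r(i)}(x_i)=\emptyset$.
   Context: $\mathbb{H}^n=\mathbb{C}^n\times\mathbb{R}$ with product $(z,\tau)(w,\sigma)=(z+w,\tau+\sigma+\tfrac12\operatorname{Im}\langle z,w\rangle)$, $\langle z,w\rangle=\sum_j\overline{z_j}w_j$; dilations $\delta_\lambda(z,\tau)=(\lambda z,\lambda^2\tau)$; $d(p,q)=\inf\{r>0:\delta_{1/r}(pq^{-1})\in B_{eucl}\}$ with $B_{eucl}$ the closed Euclidean unit ball in $\mathbb{R}^{2n+1}$. $B_r(p)=\{y:d(y,p)\le r\}$, $\partial B_r(p)=\{y:d(y,p)=r\}$, and $\partial_tB_r(p)=\{y\in\mathbb{H}^n:d(y,\partial B_r(p))\le t\}$. *)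

theory Defs
  imports "HOL-Analysis.Analysis"
begin

text \<open>The Heisenberg group H^n = C^n x R, with the complex coordinates indexed by a
finite type 'n (so n = CARD('n) >= 1 is arbitrary).\<close>

type_synonym 'n heis = "(complex ^ 'n) \<times> real"

definition herm :: "complex ^ 'n::finite \<Rightarrow> complex ^ 'n \<Rightarrow> complex" where
  "herm z w = (\<Sum>j\<in>UNIV. cnj (z $ j) * w $ j)"

definition heis_mult :: "'n::finite heis \<Rightarrow> 'n heis \<Rightarrow> 'n heis" where
  "heis_mult p q = (fst p + fst q, snd p + snd q + (1/2) * Im (herm (fst p) (fst q)))"

definition heis_inv :: "'n::finite heis \<Rightarrow> 'n heis" where
  "heis_inv p = (- fst p, - snd p)"

definition heis_dil :: "real \<Rightarrow> 'n::finite heis \<Rightarrow> 'n heis" where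
  "heis_dil c p = (c *\<^sub>R fst p, c^2 * snd p)"

definition eucl_norm :: "'n::finite heis \<Rightarrow> real" where
  "eucl_norm p = sqrt ((\<Sum>j\<in>UNIV. (cmod (fst p $ j))^2) + (snd p)^2)"

definition heis_dist :: "'n::finite heis \<Rightarrow> 'n heis \<Rightarrow> real" where
  "heis_dist p q = Inf {r. r > 0 \<and> eucl_norm (heis_dil (1/r) (heis_mult p (heis_inv q))) \<le> 1}"

definition heis_ball :: "real \<Rightarrow> 'n::finite heis \<Rightarrow> 'n heis set" where
  "heis_ball r p = {y. heis_dist y p \<le> r}"

definition heis_sphere :: "real \<Rightarrow> 'n::finite heis \<Rightarrow> 'n heis set" where
  "heis_sphere r p = {y. heis_dist y p = r}"

definition heis_setdist :: "'n::finite heis \<Rightarrow> 'n heis set \<Rightarrow> real" where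
  "heis_setdist y S = Inf (heis_dist y ` S)"

definition thick_bdry :: "real \<Rightarrow> real \<Rightarrow> 'n::finite heis \<Rightarrow> 'n heis set" where
  "thick_bdry t r p = {y. heis_setdist y (heis_sphere r p) \<le> t}"

end

theory Submission
  imports Defs "HOL-Library.Ramsey"
begin

text \<open>
  Right translation moves a point \<open>y\<close> of the intersection to the identity. By Ramsey's theorem, a
  long sequence of centres contains many centres with comparable radii or many with rapidly
  decreasing radii. In the first case the centres are separated and lie in a bounded set (after
  rescaling), which bounds their number by compactness. In the second case pass to three centres
  whose horizontal directions nearly agree and which are all far from the poles or all near the
  same pole. The gauge \<open>N\<close> satisfies \<open>N(z,\<tau>)^4 = |z|^2 N(z,\<tau>)^2 + \<tau>^2\<close>, so subtracting the equations of
  two points \<open>h\<close> and \<open>q h\<close> of the sphere of radius \<open>r\<close>, with \<open>h = (z,\<tau>)\<close> and \<open>q = (w,\<sigma>)\<close> of size \<open>s\<close> much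
  smaller than \<open>r\<close>, expresses the form \<open>2 r^2 \<langle>w,z\<rangle> + \<tau> \<omega>(w,z)\<close> by terms of order \<open>r^2 s^2\<close>. As \<open>w\<close> is
  almost opposite to \<open>z\<close>, the form is at most about \<open>- r^2 |w| |z| / 2\<close>. Away from the poles this is of
  order \<open>- r^3 s\<close>, which is too negative. Near a pole \<open>- 2 \<tau> \<sigma>\<close> dominates and the form is at least
  \<open>r^2 s^2\<close>; this forces \<open>w\<close> to be of the order of the thickness and \<open>z\<close> to be much longer than that,
  which is contradictory for the middle one of the three centres.
\<close>

section \<open>The symplectic form and the group law\<close>

text \<open>The standard symplectic form on C^n, the twist in the group law: real bilinear,
  alternating and bounded by the product of the norms.\<close>

definition symp :: "complex ^ 'n::finite \<Rightarrow> complex ^ 'n \<Rightarrow> real" where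
  "symp z w = Im (herm z w)"

lemma herm_add: "herm (x + y) z = herm x z + herm y z" "herm z (x + y) = herm z x + herm z y"
  by (simp_all add: herm_def algebra_simps sum.distrib)

lemma symp_add: "symp (x + y) z = symp x z + symp y z" "symp z (x + y) = symp z x + symp z y"
  by (simp_all add: symp_def herm_add)

lemma symp_scaleR: "symp (c *\<^sub>R x) z = c * symp x z" "symp z (c *\<^sub>R x) = c * symp z x"
  by (simp_all add: symp_def herm_def sum_distrib_left algebra_simps)

lemma symp_minus: "symp (- x) z = - symp x z" "symp z (- x) = - symp z x"
  using symp_scaleR(1)[of "-1" x z] symp_scaleR(2)[of z "-1" x] by simp_all

lemma symp_diff: "symp (x - y) z = symp x z - symp y z" "symp z (x - y) = symp z x - symp z y"
  using symp_add(1)[of x "-y" z] symp_add(2)[of z x "-y"] by (simp_all add: symp_minus)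

lemma symp_zero [simp]: "symp 0 z = 0" "symp z 0 = 0"
  using symp_scaleR(1)[of 0 z z] symp_scaleR(2)[of z 0 z] by simp_all

lemma symp_commute: "symp w z = - symp z w"
  by (simp add: symp_def herm_def sum_negf [symmetric] algebra_simps)

lemma symp_self [simp]: "symp z z = 0"
  using symp_commute[of z z] by simp

lemma abs_symp_le: "\<bar>symp z w\<bar> \<le> norm z * norm w"
proof -
  have "\<bar>symp z w\<bar> \<le> cmod (herm z w)"
    by (simp add: symp_def abs_Im_le_cmod)
  also have "\<dots> \<le> (\<Sum>j\<in>UNIV. \<bar>norm (z $ j)\<bar> * \<bar>norm (w $ j)\<bar>)"
    unfolding herm_def by (rule order_trans[OF norm_sum]) (simp add: norm_mult)
  also have "\<dots> \<le> norm z * norm w"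
    unfolding norm_vec_def by (rule L2_set_mult_ineq)
  finally show ?thesis .
qed

lemma heis_mult_eq:
  "heis_mult p q = (fst p + fst q, snd p + snd q + symp (fst p) (fst q) / 2)"
  by (simp add: heis_mult_def symp_def)

lemma fst_heis_mult [simp]: "fst (heis_mult p q) = fst p + fst q"
  and snd_heis_mult: "snd (heis_mult p q) = snd p + snd q + symp (fst p) (fst q) / 2"
  by (simp_all add: heis_mult_eq)

lemma fst_heis_inv [simp]: "fst (heis_inv p) = - fst p"
  and snd_heis_inv [simp]: "snd (heis_inv p) = - snd p"
  by (simp_all add: heis_inv_def)

lemma heis_mult_assoc: "heis_mult (heis_mult p q) u = heis_mult p (heis_mult q u)"
  by (simp add: heis_mult_eq symp_add field_simps)

lemma heis_inv_mult: "heis_inv (heis_mult p q) = heis_mult (heis_inv q) (heis_inv p)"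
  using symp_commute[of "fst p" "fst q"] by (simp add: heis_mult_eq heis_inv_def symp_minus)

lemma heis_inv_inv [simp]: "heis_inv (heis_inv p) = p"
  by (simp add: heis_inv_def)

lemma heis_mult_inv_cancel [simp]:
  "heis_mult (heis_inv p) (heis_mult p q) = q" "heis_mult p (heis_mult (heis_inv p) q) = q"
  by (simp_all add: heis_mult_eq symp_minus symp_add symp_diff)

section \<open>The gauge and its quasi-triangle inequality\<close>

text \<open>The distance to the identity. Distances are gauges of quotients, so right translations
  are isometries.\<close>

definition heis_norm :: "'n::finite heis \<Rightarrow> real" where
  "heis_norm p = Inf {r. r > 0 \<and> eucl_norm (heis_dil (1/r) p) \<le> 1}"

lemma heis_dist_eq: "heis_dist p q = heis_norm (heis_mult p (heis_inv q))"
  by (simp add: heis_dist_def heis_norm_def)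

lemma eucl_norm_dil_le_1_iff:
  assumes "r > 0"
  shows "eucl_norm (heis_dil (1/r) p) \<le> 1 \<longleftrightarrow>
    (norm (fst p))\<^sup>2 * r\<^sup>2 + (snd p)\<^sup>2 \<le> r ^ 4"
proof -
  have "(\<Sum>j\<in>UNIV. (cmod ((fst (heis_dil (1/r) p)) $ j))\<^sup>2) = (norm (fst (heis_dil (1/r) p)))\<^sup>2"
    by (simp add: norm_vec_def L2_set_def sum_nonneg)
  also have "\<dots> = (norm (fst p))\<^sup>2 / r\<^sup>2"
    using assms by (simp add: heis_dil_def power_divide)
  finally have "eucl_norm (heis_dil (1/r) p) = sqrt ((norm (fst p))\<^sup>2 / r\<^sup>2 + (snd p / r\<^sup>2)\<^sup>2)"
    by (simp add: eucl_norm_def heis_dil_def power_divide)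
  moreover have "(norm (fst p))\<^sup>2 / r\<^sup>2 + (snd p / r\<^sup>2)\<^sup>2 =
      ((norm (fst p))\<^sup>2 * r\<^sup>2 + (snd p)\<^sup>2) / r ^ 4"
    using assms by (simp add: field_simps power2_eq_square power4_eq_xxxx)
  ultimately show ?thesis
    using assms by (simp add: pos_divide_le_eq)
qed

text \<open>With A = |z|^2 and D^2 = A^2 + 4 \<tau>^2, the polynomial r^4 - A r^2 - \<tau>^2 splits
  into r^2 - (A + D)/2 and r^2 + (D - A)/2. The second factor is positive, so the first one alone
  decides which r are admissible.\<close>

lemma heis_norm_formula:
  "heis_norm p = sqrt (((norm (fst p))\<^sup>2 + sqrt ((norm (fst p)) ^ 4 + 4 * (snd p)\<^sup>2)) / 2)"
proof -
  define A where "A = (norm (fst p))\<^sup>2"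
  define D where "D = sqrt (A\<^sup>2 + 4 * (snd p)\<^sup>2)"
  define m where "m = sqrt ((A + D) / 2)"
  have A: "A \<ge> 0" "A ^ 2 = norm (fst p) ^ 4" unfolding A_def by simp_all
  have D: "D \<ge> A" "D\<^sup>2 = A\<^sup>2 + 4 * (snd p)\<^sup>2"
    unfolding D_def by (simp_all add: real_le_rsqrt)
  have m: "m \<ge> 0" "m\<^sup>2 = (A + D) / 2" unfolding m_def using A D by simp_all
  have iff: "eucl_norm (heis_dil (1/r) p) \<le> 1 \<longleftrightarrow> m \<le> r" if r: "r > 0" for r
  proof -
    have fac: "r ^ 4 - (A * r\<^sup>2 + (snd p)\<^sup>2) = (r\<^sup>2 - (A + D) / 2) * (r\<^sup>2 + (D - A) / 2)"
      using D(2) by (simp add: field_simps power2_eq_square power4_eq_xxxx)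
    have pos: "r\<^sup>2 + (D - A) / 2 > 0" using r D by (simp add: add_pos_nonneg)
    have "eucl_norm (heis_dil (1/r) p) \<le> 1 \<longleftrightarrow> 0 \<le> r ^ 4 - (A * r\<^sup>2 + (snd p)\<^sup>2)"
      using eucl_norm_dil_le_1_iff[OF r, of p] by (simp add: A_def)
    also have "\<dots> \<longleftrightarrow> m\<^sup>2 \<le> r\<^sup>2"
      unfolding fac using pos by (simp add: zero_le_mult_iff m(2))
    also have "\<dots> \<longleftrightarrow> m \<le> r"
      using m r by (simp add: power2_le_iff_abs_le)
    finally show ?thesis .
  qed
  \<comment> \<open>At the identity the constraint \<open>r > 0\<close> removes the endpoint; the
    infimum is 0 all the same.\<close>
  have set_eq: "{r. r > 0 \<and> eucl_norm (heis_dil (1/r) p) \<le> 1} = (if m = 0 then {0<..} else {m..})"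
    using iff m(1) by auto
  show ?thesis
    using m(1) unfolding heis_norm_def set_eq m_def D_def by (auto simp: A A_def)
qed

lemma heis_norm_nonneg: "heis_norm p \<ge> 0"
  by (simp add: heis_norm_formula)

text \<open>The squared gauge is a root of X^2 = |z|^2 X + \<tau>^2. In this polynomial form two
  points of one sphere can be subtracted.\<close>

lemma heis_norm_eq: "heis_norm p ^ 4 = (norm (fst p))\<^sup>2 * (heis_norm p)\<^sup>2 + (snd p)\<^sup>2"
proof -
  define A where "A = (norm (fst p))\<^sup>2"
  define D where "D = sqrt (A\<^sup>2 + 4 * (snd p)\<^sup>2)"
  have A: "A \<ge> 0" "norm (fst p) ^ 4 = A\<^sup>2" unfolding A_def by simp_all
  have D: "D \<ge> 0" "D\<^sup>2 = A\<^sup>2 + 4 * (snd p)\<^sup>2"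
    unfolding D_def by simp_all
  have N: "(heis_norm p)\<^sup>2 = (A + D) / 2"
    unfolding heis_norm_formula A(2) using A D by (simp add: A_def[symmetric] D_def[symmetric])
  have "heis_norm p ^ 4 = ((heis_norm p)\<^sup>2)\<^sup>2" by simp
  then show ?thesis
    unfolding N A_def[symmetric] using D(2) by (simp add: field_simps power2_eq_square)
qed

lemma norm_fst_le_heis_norm: "norm (fst p) \<le> heis_norm p"
proof -
  have "sqrt ((norm (fst p)) ^ 4 + 4 * (snd p)\<^sup>2) \<ge> (norm (fst p))\<^sup>2"
    by (rule real_le_rsqrt) simp
  then show ?thesis unfolding heis_norm_formula by (intro real_le_rsqrt) simp
qed

lemma abs_snd_le_heis_norm: "\<bar>snd p\<bar> \<le> (heis_norm p)\<^sup>2"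
proof -
  have "(snd p)\<^sup>2 \<le> heis_norm p ^ 4"
    using heis_norm_eq[of p] by simp
  then have "\<bar>snd p\<bar>\<^sup>2 \<le> ((heis_norm p)\<^sup>2)\<^sup>2" by simp
  then show ?thesis by (rule power2_le_imp_le) simp
qed

lemma half_sum_le: "(x + s) / 2 \<le> 4 * y" if "s \<le> 3 * y" "x \<le> y" "0 \<le> y" for x s y :: real
  using that by simp

text \<open>Converse, up to a factor, of the two coordinate bounds: as 1 + 4 \<le> 9, the inner root
  is at most 3 a^2, and (1 + 3)/2 \<le> 4.\<close>

lemma heis_norm_le:
  assumes "norm (fst p) \<le> a" "\<bar>snd p\<bar> \<le> a\<^sup>2"
  shows "heis_norm p \<le> 2 * a"
proof -
  have a: "a \<ge> 0" using assms(1) norm_ge_zero[of "fst p"] by linarith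
  have 1: "(norm (fst p))\<^sup>2 \<le> a\<^sup>2" using assms by (simp add: power_mono)
  have 2: "norm (fst p) ^ 4 \<le> a ^ 4" using assms by (simp add: power_mono)
  have "\<bar>snd p\<bar>\<^sup>2 \<le> (a\<^sup>2)\<^sup>2" using assms(2) by (rule power_mono) simp
  have "norm (fst p) ^ 4 + 4 * (snd p)\<^sup>2 \<le> (3 * a\<^sup>2)\<^sup>2"
  proof -
    have "(3 * a\<^sup>2)\<^sup>2 = 9 * a ^ 4" "(a\<^sup>2)\<^sup>2 = a ^ 4" "0 \<le> a ^ 4"
      by (simp_all add: power_mult_distrib)
    then show ?thesis using \<open>\<bar>snd p\<bar>\<^sup>2 \<le> (a\<^sup>2)\<^sup>2\<close> 2 unfolding power2_abs by linarith
  qed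
  then have "sqrt (norm (fst p) ^ 4 + 4 * (snd p)\<^sup>2) \<le> 3 * a\<^sup>2"
    by (rule real_le_lsqrt[rotated -1]) auto
  then have "((norm (fst p))\<^sup>2 + sqrt ((norm (fst p)) ^ 4 + 4 * (snd p)\<^sup>2)) / 2 \<le> 4 * a\<^sup>2"
    by (rule half_sum_le[OF _ 1]) simp
  then show ?thesis
    unfolding heis_norm_formula using a by (intro real_le_lsqrt) (auto simp: power_mult_distrib)
qed

lemma heis_norm_inv [simp]: "heis_norm (heis_inv p) = heis_norm p"
  by (simp add: heis_norm_formula)

text \<open>With a the sum of the two gauges, the cross term of a^2 absorbs the symplectic
  twist.\<close>

lemma heis_norm_mult_le: "heis_norm (heis_mult p q) \<le> 2 * (heis_norm p + heis_norm q)"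
proof (rule heis_norm_le)
  note b = norm_fst_le_heis_norm[of p] norm_fst_le_heis_norm[of q]
  show "norm (fst (heis_mult p q)) \<le> heis_norm p + heis_norm q"
    using b norm_triangle_ineq[of "fst p" "fst q"] by simp
  have "\<bar>symp (fst p) (fst q)\<bar> \<le> heis_norm p * heis_norm q"
    using abs_symp_le[of "fst p" "fst q"] mult_mono[OF b] heis_norm_nonneg[of p] by simp
  moreover have "heis_norm p * heis_norm q \<ge> 0" by (simp add: heis_norm_nonneg)
  ultimately have "\<bar>snd (heis_mult p q)\<bar> \<le>
      (heis_norm p)\<^sup>2 + (heis_norm q)\<^sup>2 + 2 * (heis_norm p * heis_norm q)"
    using abs_snd_le_heis_norm[of p] abs_snd_le_heis_norm[of q]
    unfolding snd_heis_mult by linarith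
  then show "\<bar>snd (heis_mult p q)\<bar> \<le> (heis_norm p + heis_norm q)\<^sup>2"
    by (simp add: power2_sum)
qed

section \<open>Points of a thickened sphere\<close>

text \<open>Makes the infimum in \<open>heis_setdist\<close> meaningful. The witness is a translate
  of the pole \<open>(0, r^2)\<close>, whose gauge is \<open>r\<close>.\<close>

lemma heis_sphere_nonempty:
  assumes "r \<ge> 0"
  shows "heis_sphere r p \<noteq> {}"
proof -
  have "heis_norm (0, r\<^sup>2) = r"
  proof -
    have "sqrt (4 * (r\<^sup>2)\<^sup>2) = 2 * r\<^sup>2" by (rule real_sqrt_unique) auto
    then show ?thesis using assms by (simp add: heis_norm_formula)
  qed
  then have "heis_mult (0, r\<^sup>2) p \<in> heis_sphere r p"
    by (simp add: heis_sphere_def heis_dist_eq heis_mult_eq symp_minus)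
  then show ?thesis by blast
qed

text \<open>The strict gap \<open>t < s\<close> yields a sphere point b at distance below
  \<open>s\<close>; inserting b splits the quotient.\<close>

lemma thick_bdryE:
  assumes "y \<in> thick_bdry t r p" "r \<ge> 0" "t < s"
  obtains g h where "heis_mult y (heis_inv p) = heis_mult g h" "heis_norm g \<le> s" "heis_norm h = r"
proof -
  have "Inf (heis_dist y ` heis_sphere r p) < s"
    using assms(1,3) by (simp add: thick_bdry_def heis_setdist_def)
  then obtain b where b: "b \<in> heis_sphere r p" "heis_dist y b < s"
    using cInf_lessD[of "heis_dist y ` heis_sphere r p" s] heis_sphere_nonempty[OF assms(2), of p]
    by (auto simp del: split_paired_Ex)
  show thesis
  proof
    show "heis_mult y (heis_inv p) = heis_mult (heis_mult y (heis_inv b)) (heis_mult b (heis_inv p))"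
      by (simp add: heis_mult_assoc)
  qed (use b in \<open>auto simp: heis_sphere_def heis_dist_eq\<close>)
qed

section \<open>Pigeonhole principle in bounded sets\<close>

text \<open>Finitely many balls of radius \<delta>/2 cover the closure, and one of them receives
  many points. The bound is uniform in \<open>S\<close> and \<open>f\<close>.\<close>

lemma bounded_pigeonhole:
  fixes K :: "'a::heine_borel set"
  assumes "bounded K" "\<delta> > 0"
  shows "\<exists>M. \<forall>S (f :: 'b \<Rightarrow> 'a). finite S \<longrightarrow> M \<le> card S \<longrightarrow> f ` S \<subseteq> K \<longrightarrow>
    (\<exists>T\<subseteq>S. card T = n \<and> (\<forall>x\<in>T. \<forall>y\<in>T. dist (f x) (f y) < \<delta>))"
proof -
  have "compact (closure K)" using assms(1) by simp
  then obtain C where C: "finite C" "closure K \<subseteq> (\<Union>x\<in>C. ball x (\<delta>/2))"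
    using seq_compact_imp_totally_bounded[of "closure K"] assms(2)
    by (meson compact_imp_seq_compact half_gt_zero)
  show ?thesis
  \<comment> \<open>The extra 1 keeps \<open>S\<close> nonempty and gives a strict inequality from
    which \<open>card C\<close> cancels.\<close>
  proof (rule exI[of _ "n * card C + 1"], intro allI impI)
    fix S :: "'b set" and f :: "'b \<Rightarrow> 'a"
    assume S: "finite S" "n * card C + 1 \<le> card S" "f ` S \<subseteq> K"
    have "\<forall>x\<in>S. \<exists>c\<in>C. f x \<in> ball c (\<delta>/2)"
      using S(3) C(2) closure_subset[of K] by blast
    then obtain c where c: "\<And>x. x \<in> S \<Longrightarrow> c x \<in> C \<and> f x \<in> ball (c x) (\<delta>/2)"
      by metis
    have "S \<noteq> {}" using S(2) by auto
    then have "C \<noteq> {}" using c by blast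
    then obtain a where "card S \<le> card (c -` {a} \<inter> S) * card C"
      using pigeonhole_card[of c S C] c S(1) C(1) by auto
    then have "n * card C < card (c -` {a} \<inter> S) * card C" using S(2) by linarith
    then have a: "n \<le> card (c -` {a} \<inter> S)" by simp
    then obtain T where T: "T \<subseteq> c -` {a} \<inter> S" "card T = n"
      by (meson obtain_subset_with_card_n)
    have "dist (f x) (f y) < \<delta>" if "x \<in> T" "y \<in> T" for x y
    proof -
      have "dist a (f x) < \<delta>/2" "dist a (f y) < \<delta>/2"
        using that T c by (auto simp: subset_iff)
      then show ?thesis using dist_triangle3[of "f x" "f y" a] by linarith
    qed
    then show "\<exists>T\<subseteq>S. card T = n \<and> (\<forall>x\<in>T. \<forall>y\<in>T. dist (f x) (f y) < \<delta>)"
      using T by blast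
  qed
qed

section \<open>The form controlling two points of one sphere\<close>

text \<open>The difference of two instances of \<open>heis_norm_eq\<close>. Left are the terms
  depending on the relative horizontal direction; right are two squares and the product of heights,
  which decides the pole case.\<close>

lemma sphere_difference:
  assumes "heis_norm h = r" "heis_norm (heis_mult q h) = r"
  shows "2 * r\<^sup>2 * (fst q \<bullet> fst h) + snd h * symp (fst q) (fst h) =
    - (r\<^sup>2 * (norm (fst q))\<^sup>2) - (snd q + symp (fst q) (fst h) / 2)\<^sup>2 - 2 * snd h * snd q"
proof -
  have 1: "r ^ 4 = (norm (fst h))\<^sup>2 * r\<^sup>2 + (snd h)\<^sup>2"
    using heis_norm_eq[of h] assms(1) by simp
  have 2: "r ^ 4 = (norm (fst q + fst h))\<^sup>2 * r\<^sup>2 + (snd q + snd h + symp (fst q) (fst h) / 2)\<^sup>2"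
    using heis_norm_eq[of "heis_mult q h"] assms(2) by (simp add: snd_heis_mult)
  have 3: "(norm (fst q + fst h))\<^sup>2 = (norm (fst q))\<^sup>2 + 2 * (fst q \<bullet> fst h) + (norm (fst h))\<^sup>2"
    by (simp add: power2_norm_eq_inner inner_add_left inner_add_right inner_commute)
  show ?thesis using 1 2 unfolding 3 by (simp add: power2_eq_square algebra_simps)
qed

lemma abs_form_le:
  assumes "\<bar>\<tau>\<bar> \<le> \<rho>"
  shows "\<bar>2 * \<rho> * (x \<bullet> y) + \<tau> * symp x y\<bar> \<le> 3 * \<rho> * (norm x * norm y)"
proof -
  have "\<bar>2 * \<rho> * (x \<bullet> y)\<bar> \<le> 2 * \<rho> * (norm x * norm y)"
    using assms Cauchy_Schwarz_ineq2[of x y] by (simp add: abs_mult mult_left_mono)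
  moreover have "\<bar>\<tau> * symp x y\<bar> \<le> \<rho> * (norm x * norm y)"
    unfolding abs_mult using assms abs_symp_le[of x y] by (intro mult_mono) auto
  ultimately show ?thesis by linarith
qed

text \<open>For parallel vectors the symplectic part vanishes and the value is 2 \<rho> |u| |v|. A
  deviation of 1/2 in direction costs at most 3/2 of \<rho> |u| |v|.\<close>

lemma form_aligned_ge:
  assumes "\<bar>\<tau>\<bar> \<le> \<rho>" "dist (sgn u) (sgn v) < 1/2"
  shows "2 * \<rho> * (v \<bullet> u) + \<tau> * symp v u \<ge> \<rho> * (norm u * norm v) / 2"
proof (cases "u = 0 \<or> v = 0")
  case True
  then show ?thesis by auto
next
  case False
  have \<rho>: "\<rho> \<ge> 0" using assms(1) by linarith
  define e where "e = sgn u"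
  define d where "d = sgn v - sgn u"
  have e: "norm e = 1" using False by (simp add: e_def norm_sgn)
  have d: "norm d \<le> 1/2" using assms(2) by (simp add: d_def dist_norm norm_minus_commute)
  have u: "u = norm u *\<^sub>R e" and v: "v = norm v *\<^sub>R (e + d)"
    using False by (simp_all add: e_def d_def sgn_div_norm)
  have "2 * \<rho> * (e \<bullet> e) + \<tau> * symp e e = 2 * \<rho>"
    using e by (simp add: norm_eq_1)
  moreover have "\<bar>2 * \<rho> * (d \<bullet> e) + \<tau> * symp d e\<bar> \<le> 3 * \<rho> * (norm d * norm e)"
    by (rule abs_form_le[OF assms(1)])
  moreover have "3 * \<rho> * (norm d * norm e) \<le> 3 * \<rho> * (1/2)"
    using e d \<rho> by (intro mult_left_mono) auto
  moreover have "2 * \<rho> * ((e + d) \<bullet> e) + \<tau> * symp (e + d) e =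
      (2 * \<rho> * (e \<bullet> e) + \<tau> * symp e e) + (2 * \<rho> * (d \<bullet> e) + \<tau> * symp d e)"
    by (simp add: inner_add_left symp_add algebra_simps)
  ultimately have "\<rho> / 2 \<le> 2 * \<rho> * ((e + d) \<bullet> e) + \<tau> * symp (e + d) e"
    by linarith
  then have "norm u * norm v * (\<rho> / 2) \<le> norm u * norm v * (2 * \<rho> * ((e + d) \<bullet> e) + \<tau> * symp (e + d) e)"
    by (rule mult_left_mono) simp
  also have "\<dots> = 2 * \<rho> * ((norm v *\<^sub>R (e + d)) \<bullet> (norm u *\<^sub>R e)) + \<tau> * symp (norm v *\<^sub>R (e + d)) (norm u *\<^sub>R e)"
    unfolding symp_scaleR inner_scaleR_left inner_scaleR_right by (simp add: algebra_simps)
  finally show ?thesis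
    unfolding u[symmetric] v[symmetric] by (simp add: algebra_simps)
qed

text \<open>Expand bilinearly with w = a - v and z = u + b. The pair v, u gives the negative main
  term; the other three pairs are errors bounded by \<open>abs_form_le\<close>.\<close>

lemma form_perturbed_le:
  assumes "\<bar>\<tau>\<bar> \<le> \<rho>" "dist (sgn u) (sgn v) < 1/2" "norm (w + v) \<le> 2 * t" "norm (z - u) \<le> t"
  shows "2 * \<rho> * (w \<bullet> z) + \<tau> * symp w z \<le>
    \<rho> * (- (norm u * norm v) / 2 + 3 * t * norm v + 6 * t * norm u + 6 * t\<^sup>2)"
proof -
  define a where "a = w + v"
  define b where "b = z - u"
  have w: "w = a - v" and z: "z = u + b" by (simp_all add: a_def b_def)
  have \<rho>: "\<rho> \<ge> 0" using assms(1) by linarith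
  have t: "t \<ge> 0" using assms(4) norm_ge_zero[of "z - u"] by linarith
  note F = abs_form_le[OF assms(1)]
  have "2 * \<rho> * (w \<bullet> z) + \<tau> * symp w z =
    - (2 * \<rho> * (v \<bullet> u) + \<tau> * symp v u) - (2 * \<rho> * (v \<bullet> b) + \<tau> * symp v b)
    + (2 * \<rho> * (a \<bullet> u) + \<tau> * symp a u) + (2 * \<rho> * (a \<bullet> b) + \<tau> * symp a b)"
    unfolding w z by (simp add: inner_add_right inner_diff_left symp_add symp_diff algebra_simps)
  moreover have "\<rho> * (norm u * norm v) / 2 \<le> 2 * \<rho> * (v \<bullet> u) + \<tau> * symp v u"
    by (rule form_aligned_ge[OF assms(1,2)])
  moreover have "3 * \<rho> * (norm v * norm b) \<le> 3 * \<rho> * (norm v * t)"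
    using \<rho> assms(4) by (intro mult_left_mono) (auto simp: b_def)
  moreover have "3 * \<rho> * (norm a * norm u) \<le> 3 * \<rho> * (2 * t * norm u)"
    using \<rho> assms(3) by (intro mult_left_mono mult_right_mono) (auto simp: a_def)
  moreover have "3 * \<rho> * (norm a * norm b) \<le> 3 * \<rho> * (2 * t * t)"
    using \<rho> t assms(3,4) by (intro mult_left_mono mult_mono) (auto simp: a_def b_def)
  moreover have "\<rho> * (- (norm u * norm v) / 2 + 3 * t * norm v + 6 * t * norm u + 6 * t\<^sup>2) =
      - (\<rho> * (norm u * norm v) / 2) + 3 * \<rho> * (norm v * t) + 3 * \<rho> * (2 * t * norm u) + 3 * \<rho> * (2 * t * t)"
    by (simp add: power2_eq_square algebra_simps)
  ultimately show ?thesis using F[of v b] F[of a u] F[of a b] by linarith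
qed

section \<open>Numerical estimates\<close>

lemma abs_add_half_le:
  fixes X :: real
  assumes "\<bar>s\<bar> \<le> 2 * (X / 10 ^ 6)" "\<bar>w\<bar> \<le> c * X" "0 < X" "1/50 \<le> c"
  shows "\<bar>s + w / 2\<bar> \<le> c * X"
proof -
  have "\<bar>s + w / 2\<bar> \<le> \<bar>s\<bar> + \<bar>w / 2\<bar>" by (rule abs_triangle_ineq)
  also have "\<dots> \<le> X / 100 + c * X / 2" using assms by (intro add_mono) simp_all
  also have "X / 100 \<le> c * X / 2" using mult_right_mono[OF assms(4), of X] assms(3) by simp
  finally show ?thesis by (simp add: mult.commute)
qed

text \<open>Used with W = (r j)^2 (r k)^2 and D the product of the two heights; 1/2500 is (1/50)^2
  and 9801/10000 is (99/100)^2. Then - 2 C exceeds 1.95 W and outweighs A and B.\<close>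

lemma pole_arith:
  fixes A B C D W :: real
  assumes "A \<le> W / 2500" "B \<le> W / 2500" "C + D \<le> W / 10 ^ 6" "9801 / 10000 * W \<le> D" "0 \<le> W"
  shows "W \<le> - A - B - 2 * C"
proof -
  have "C \<le> - (979/1000 * W)" using assms(3-5) by simp
  then show ?thesis using assms(1,2,5) by simp
qed

lemma nonpole_arith1:
  fixes A B C W :: real
  assumes "A \<le> 9 * W" "B \<le> 9 * W" "C \<le> 4 * W"
  shows "- (22 * W) \<le> - A - B - C"
  using assms by simp

text \<open>Used with W = (r k)^2 and X = r k r j. The errors sum to at most 26 X / 10^6, below P/2,
  which is at least 50 X / 10^6.\<close>

lemma nonpole_arith2:
  fixes P Q S E W X :: real
  assumes "Q \<le> 2 * W / 10 ^ 7" "S \<le> 2 * X / 10 ^ 7" "E \<le> W / 10 ^ 14" "X / 10 ^ 4 \<le> P"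
    "- (22 * W) \<le> - P / 2 + 3 * Q + 6 * S + 6 * E" "0 < X" "W \<le> X / 10 ^ 6"
  shows False
proof -
  have "3 * Q \<le> X / 10 ^ 6" "6 * S \<le> 2 * X / 10 ^ 6" "6 * E \<le> X / 10 ^ 6" "22 * W \<le> 22 * X / 10 ^ 6"
    using assms by simp_all
  then have "X / 10 ^ 4 \<le> 52 * X / 10 ^ 6" using assms(4,5) by simp
  then show False using assms(6) by simp
qed

text \<open>For P = U V, Q = t V, S = t U, E = t^2 the left side of the conclusion is (U - 6 t)(V -
  12 t); it arises by doubling the first hypothesis.\<close>

lemma pole_arith2:
  fixes P Q S E X W :: real
  assumes "W \<le> - P / 2 + 3 * Q + 6 * S + 6 * E" "E \<le> W / 10 ^ 14" "X \<le> W / 10 ^ 7" "0 < W"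
  shows "P - 12 * S - 6 * Q + 72 * E < - 6 * X"
  using assms by simp

lemma pole_arith3:
  fixes P Q S E X W :: real
  assumes "W \<le> - P / 2 + 3 * Q + 6 * S + 6 * E" "E \<le> W / 10 ^ 14" "Q \<le> 12 * E" "0 \<le> P" "0 < W"
  shows "W \<le> 12 * S"
  using assms by simp

section \<open>Configurations of nearly spherical position\<close>

text \<open>For centres \<open>x j\<close> and a point \<open>y\<close> of the intersection, \<open>p j\<close> stands for \<open>y (x j)\<inverse>\<close>, so that
  \<open>(p k)\<inverse> (p j) = (x k) (x j)\<inverse>\<close>. That a point lies close to the sphere of radius \<open>r j\<close> about \<open>x j\<close>
  is recorded by a factorisation into a small element and an element of gauge exactly \<open>r j\<close>. Membership
  in the thickened sphere only gives an infimum, so here \<open>t\<close> is twice the thickness.\<close>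

locale near_spheres =
  fixes I :: "nat set" and t r :: "nat \<Rightarrow> real"
    and p g h :: "nat \<Rightarrow> 'n::finite heis" and a b :: "nat \<Rightarrow> nat \<Rightarrow> 'n heis"
  assumes t_pos: "j \<in> I \<Longrightarrow> t j > 0"
    and t_le: "\<lbrakk>j \<in> I; k \<in> I; j \<le> k\<rbrakk> \<Longrightarrow> 10 ^ 7 * t j \<le> r k"
    and p_eq: "j \<in> I \<Longrightarrow> p j = heis_mult (g j) (h j)"
    and norm_g: "j \<in> I \<Longrightarrow> heis_norm (g j) \<le> t j"
    and norm_h: "j \<in> I \<Longrightarrow> heis_norm (h j) = r j"
    and quotient_eq: "\<lbrakk>j \<in> I; k \<in> I; j < k\<rbrakk> \<Longrightarrow>
      heis_mult (heis_inv (p k)) (p j) = heis_mult (a j k) (b j k)"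
    and norm_a: "\<lbrakk>j \<in> I; k \<in> I; j < k\<rbrakk> \<Longrightarrow> heis_norm (a j k) \<le> t j"
    and norm_b: "\<lbrakk>j \<in> I; k \<in> I; j < k\<rbrakk> \<Longrightarrow> heis_norm (b j k) = r j"
begin

lemma r_pos: "j \<in> I \<Longrightarrow> r j > 0"
  using t_pos[of j] t_le[of j j] by simp

lemma norm_fst_g: "j \<in> I \<Longrightarrow> norm (fst (g j)) \<le> t j"
  using norm_fst_le_heis_norm norm_g order_trans by blast

lemma norm_fst_h: "j \<in> I \<Longrightarrow> norm (fst (h j)) \<le> r j"
  using norm_fst_le_heis_norm norm_h by metis

lemma abs_snd_h: "j \<in> I \<Longrightarrow> \<bar>snd (h j)\<bar> \<le> (r j)\<^sup>2"
  using abs_snd_le_heis_norm norm_h by metis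

lemma abs_snd_g: "j \<in> I \<Longrightarrow> \<bar>snd (g j)\<bar> \<le> (t j)\<^sup>2"
  using abs_snd_le_heis_norm[of "g j"] power_mono[OF norm_g[of j] heis_norm_nonneg, of 2] by linarith

lemma fst_h_diff: "j \<in> I \<Longrightarrow> norm (fst (h j) - fst (p j)) \<le> t j"
  using norm_fst_g[of j] by (simp add: p_eq)

lemma norm_fst_p: "j \<in> I \<Longrightarrow> norm (fst (p j)) \<le> 2 * r j"
  using norm_triangle_ineq[of "fst (g j)" "fst (h j)"] norm_fst_g[of j] norm_fst_h[of j]
    t_le[of j j] t_pos[of j] by (simp add: p_eq)

lemma heis_norm_p_le: "j \<in> I \<Longrightarrow> heis_norm (p j) \<le> 4 * r j"
  using heis_norm_mult_le[of "g j" "h j"] norm_g[of j] norm_h[of j] t_le[of j j] t_pos[of j]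
  by (simp add: p_eq)

text \<open>Both \<open>h j\<close> and \<open>(q j k) (h j) = b j k\<close> lie exactly on the sphere of radius \<open>r j\<close>. Comparing
  gauges only, i.e. using that \<open>p j\<close> has gauge \<open>r j\<close> up to \<open>t j\<close>, would lose too much near the poles,
  because the distance is not a length metric.\<close>

definition q :: "nat \<Rightarrow> nat \<Rightarrow> 'n heis" where
  "q j k = heis_mult (heis_inv (a j k)) (heis_mult (heis_inv (p k)) (g j))"

context
  fixes j k
  assumes jk: "j \<in> I" "k \<in> I" "j < k"
begin

lemma heis_norm_q_h: "heis_norm (heis_mult (q j k) (h j)) = r j"
proof -
  have "heis_mult (q j k) (h j) = b j k"
    using quotient_eq[OF jk] p_eq[OF jk(1)] by (simp add: q_def heis_mult_assoc)
  then show ?thesis using norm_b[OF jk] by simp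
qed

lemma norm_fst_a: "norm (fst (a j k)) \<le> t j"
  using norm_fst_le_heis_norm norm_a[OF jk] order_trans by blast

lemma abs_snd_a: "\<bar>snd (a j k)\<bar> \<le> (t j)\<^sup>2"
  using abs_snd_le_heis_norm[of "a j k"] power_mono[OF norm_a[OF jk] heis_norm_nonneg, of 2] by linarith

lemma fst_q_add: "norm (fst (q j k) + fst (p k)) \<le> 2 * t j"
  using norm_fst_a norm_fst_g[OF jk(1)] norm_triangle_ineq4[of "fst (g j)" "fst (a j k)"]
  by (simp add: q_def)

lemma tj_small: "t j \<le> r k / 10 ^ 7" "0 < t j" "t k \<le> r k / 10 ^ 7" "0 < t k" "0 < r k" "0 < r j"
  using t_le[of j k] t_le[of k k] jk t_pos r_pos by auto

text \<open>Expanding \<open>q j k\<close> and \<open>p k\<close> by the group law cancels the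
  height of \<open>h k\<close>. Seven terms remain, each with a factor of thickness and hence at
  most (r k)^2 / 10^7.\<close>

lemma snd_q_add: "\<bar>snd (q j k) + snd (h k)\<bar> \<le> (r k)\<^sup>2 / 10 ^ 6"
proof -
  note T = tj_small
  define zp where "zp = fst (p k)"
  have zp: "norm zp \<le> 2 * r k" using norm_fst_p jk by (simp add: zp_def)
  have s1: "\<bar>symp zp (fst (g j)) / 2\<bar> \<le> r k * t j"
    using abs_symp_le[of zp "fst (g j)"] mult_mono[OF zp norm_fst_g[OF jk(1)]] T by simp
  have s2: "\<bar>symp (fst (a j k)) zp / 2\<bar> \<le> t j * r k"
    using abs_symp_le[of "fst (a j k)" zp] mult_mono[OF norm_fst_a zp] T by simp
  have s3: "\<bar>symp (fst (a j k)) (fst (g j))\<bar> \<le> t j * t j"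
    using abs_symp_le[of "fst (a j k)" "fst (g j)"] mult_mono[OF norm_fst_a norm_fst_g[OF jk(1)]] T
    by simp
  have s4: "\<bar>symp (fst (g k)) (fst (h k))\<bar> \<le> t k * r k"
    using abs_symp_le[of "fst (g k)" "fst (h k)"] mult_mono[OF norm_fst_g[OF jk(2)] norm_fst_h[OF jk(2)]] T
    by simp
  have half: "\<bar>x / 2\<bar> \<le> y" if "\<bar>x\<bar> \<le> y" for x y :: real
    using that by simp
  have sum: "\<bar>- x1 + x2 - x3 + x4 - x5 - x6 - x7\<bar> \<le> y1 + y2 + y3 + y4 + y5 + y6 + y7"
    if "\<bar>x1\<bar> \<le> y1" "\<bar>x2\<bar> \<le> y2" "\<bar>x3\<bar> \<le> y3" "\<bar>x4\<bar> \<le> y4" "\<bar>x5\<bar> \<le> y5" "\<bar>x6\<bar> \<le> y6" "\<bar>x7\<bar> \<le> y7"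
    for x1 x2 x3 x4 x5 x6 x7 y1 y2 y3 y4 y5 y6 y7 :: real
    using that by linarith
  have "snd (q j k) + snd (h k) = - snd (a j k) + snd (g j) - symp zp (fst (g j)) / 2
      + symp (fst (a j k)) zp / 2 - symp (fst (a j k)) (fst (g j)) / 2
      - snd (g k) - symp (fst (g k)) (fst (h k)) / 2"
    using p_eq[OF jk(2)]
    by (simp add: q_def zp_def snd_heis_mult symp_minus symp_add symp_diff field_simps)
  also have "\<bar>\<dots>\<bar> \<le> (t j)\<^sup>2 + (t j)\<^sup>2 + r k * t j + t j * r k + t j * t j + (t k)\<^sup>2 + t k * r k"
    using abs_snd_a abs_snd_g[OF jk(1)] s1 s2 half[OF s3] abs_snd_g[OF jk(2)] half[OF s4] by (rule sum)
  finally have "\<bar>snd (q j k) + snd (h k)\<bar> \<le>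
    (t j)\<^sup>2 + (t j)\<^sup>2 + r k * t j + t j * r k + t j * t j + (t k)\<^sup>2 + t k * r k" .
  moreover define c where "c = r k * r k"
  have "0 \<le> c" by (simp add: c_def)
  moreover have "t j * t j \<le> c / 10 ^ 7" "r k * t j \<le> c / 10 ^ 7" "t j * r k \<le> c / 10 ^ 7"
     "t k * t k \<le> c / 10 ^ 7" "t k * r k \<le> c / 10 ^ 7"
    using T mult_mono[of "t j" "r k" "t j" "r k / 10 ^ 7"] mult_mono[of "r k" "r k" "t j" "r k / 10 ^ 7"]
      mult_mono[of "t k" "r k" "t k" "r k / 10 ^ 7"] mult_mono[of "r k" "r k" "t k" "r k / 10 ^ 7"]
    by (simp_all add: c_def mult.commute)
  ultimately show ?thesis unfolding power2_eq_square c_def[symmetric] by simp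
qed

text \<open>Horizontally \<open>q j k\<close> is the opposite of \<open>p k\<close> up to two small
  elements, and \<open>h j\<close> is \<open>p j\<close> up to one.\<close>

lemma form_le:
  assumes "dist (sgn (fst (p j))) (sgn (fst (p k))) < 1/2"
  shows "2 * (r j)\<^sup>2 * (fst (q j k) \<bullet> fst (h j)) + snd (h j) * symp (fst (q j k)) (fst (h j)) \<le>
    (r j)\<^sup>2 * (- (norm (fst (p j)) * norm (fst (p k))) / 2 + 3 * t j * norm (fst (p k))
      + 6 * t j * norm (fst (p j)) + 6 * (t j)\<^sup>2)"
  by (rule form_perturbed_le) (use jk abs_snd_h fst_q_add fst_h_diff assms in auto)

lemma form_eq:
  "2 * (r j)\<^sup>2 * (fst (q j k) \<bullet> fst (h j)) + snd (h j) * symp (fst (q j k)) (fst (h j)) =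
    - ((r j)\<^sup>2 * (norm (fst (q j k)))\<^sup>2) - (snd (q j k) + symp (fst (q j k)) (fst (h j)) / 2)\<^sup>2
    - 2 * snd (h j) * snd (q j k)"
  by (rule sphere_difference[OF norm_h[OF jk(1)] heis_norm_q_h])

end

lemma abs_form_symp: 
  assumes "j \<in> I" "k \<in> I" "j < k" "norm (fst (q j k)) \<le> c * r k"
  shows "\<bar>symp (fst (q j k)) (fst (h j))\<bar> \<le> c * r k * r j"
proof -
  have "0 \<le> c * r k" using assms(4) norm_ge_zero order_trans by blast
  then show ?thesis
    using abs_symp_le[of "fst (q j k)" "fst (h j)"] mult_mono[OF assms(4) norm_fst_h[OF assms(1)]]
    by simp
qed

section \<open>Pairs with rapidly decreasing radii\<close>

text \<open>After division by (r j)^2, \<open>form_eq\<close> bounds the form below by - 22 (r k)^2,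
  where 22 = 9 + 9 + 4, while \<open>form_le\<close> makes it negative of order r j r k. The gap
  between the radii makes these incompatible.\<close>

lemma nonpole_contradiction:
  assumes jk: "j \<in> I" "k \<in> I" "j < k"
    and aligned: "dist (sgn (fst (p j))) (sgn (fst (p k))) < 1/2"
    and fast: "r k \<le> r j / 10 ^ 6"
    and u: "norm (fst (p j)) \<ge> r j / 100" and v: "norm (fst (p k)) \<ge> r k / 100"
  shows False
proof -
  note T = tj_small[OF jk]
  define w where "w = norm (fst (q j k))"
  define \<sigma> where "\<sigma> = snd (q j k)"
  define \<omega> where "\<omega> = symp (fst (q j k)) (fst (h j))"
  define \<tau> where "\<tau> = snd (h j)"
  define U where "U = norm (fst (p j))"
  define V where "V = norm (fst (p k))"
  have U: "U \<le> 2 * r j" "U \<ge> r j / 100" and V: "V \<le> 2 * r k" "V \<ge> r k / 100"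
    using u v norm_fst_p jk by (auto simp: U_def V_def)
  have rr: "0 < r k * r j" "r k * r k \<le> r k * r j / 10 ^ 6"
    using T fast mult_left_mono[OF fast, of "r k"] by auto
  have w: "0 \<le> w" "w \<le> 3 * r k"
    using fst_q_add[OF jk] norm_triangle_ineq4[of "fst (q j k) + fst (p k)" "fst (p k)"] V(1) T
    unfolding w_def V_def by auto
  have \<omega>: "\<bar>\<omega>\<bar> \<le> 3 * (r k * r j)"
    using abs_form_symp[OF jk, of 3] w(2) by (simp add: w_def \<omega>_def mult.assoc)
  have \<tau>: "\<bar>\<tau>\<bar> \<le> (r j)\<^sup>2" using abs_snd_h jk by (simp add: \<tau>_def)
  have \<sigma>: "\<bar>\<sigma>\<bar> \<le> 2 * (r k)\<^sup>2"
  proof -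
    have "(r k)\<^sup>2 / 10 ^ 6 \<le> (r k)\<^sup>2" by simp
    then show ?thesis
      using snd_q_add[OF jk] abs_snd_h[OF jk(2)] unfolding \<sigma>_def by linarith
  qed
  have "(r j)\<^sup>2 * w\<^sup>2 \<le> (r j)\<^sup>2 * (3 * r k)\<^sup>2"
    using w T by (intro mult_left_mono power_mono) auto
  moreover have "(\<sigma> + \<omega> / 2)\<^sup>2 \<le> (3 * (r k * r j))\<^sup>2"
  proof -
    \<comment> \<open>\<sigma> is of order (r k)^2, which \<open>fast\<close> makes negligible
      against the bound r k r j for \<omega>.\<close>
    have "\<bar>\<sigma>\<bar> \<le> 2 * (r k * r j / 10 ^ 6)" using \<sigma> rr unfolding power2_eq_square by linarith
    then have "\<bar>\<sigma> + \<omega> / 2\<bar> \<le> 3 * (r k * r j)" using \<omega> rr(1) by (rule abs_add_half_le) simp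
    from power_mono[OF this abs_ge_zero, of 2] show ?thesis unfolding power2_abs .
  qed
  moreover have "2 * \<tau> * \<sigma> \<le> 2 * ((r j)\<^sup>2 * (2 * (r k)\<^sup>2))"
  proof -
    have "\<bar>\<tau> * \<sigma>\<bar> \<le> (r j)\<^sup>2 * (2 * (r k)\<^sup>2)"
      unfolding abs_mult using \<tau> \<sigma> by (intro mult_mono) auto
    then have "2 * (\<tau> * \<sigma>) \<le> 2 * ((r j)\<^sup>2 * (2 * (r k)\<^sup>2))"
      by (rule mult_left_mono[OF abs_le_D1]) simp
    then show ?thesis by (simp only: mult.assoc)
  qed
  ultimately have "- (22 * ((r j)\<^sup>2 * (r k)\<^sup>2)) \<le> - ((r j)\<^sup>2 * w\<^sup>2) - (\<sigma> + \<omega> / 2)\<^sup>2 - 2 * \<tau> * \<sigma>"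
    using nonpole_arith1[of "(r j)\<^sup>2 * w\<^sup>2" "(r j)\<^sup>2 * (r k)\<^sup>2" "(\<sigma> + \<omega> / 2)\<^sup>2" "2 * \<tau> * \<sigma>"]
    by (simp add: power_mult_distrib mult.commute mult.left_commute)
  also have "\<dots> \<le> (r j)\<^sup>2 * (- (U * V) / 2 + 3 * t j * V + 6 * t j * U + 6 * (t j)\<^sup>2)"
    using form_le[OF jk aligned] form_eq[OF jk] unfolding U_def V_def w_def \<omega>_def \<sigma>_def \<tau>_def by simp
  finally have "(r j)\<^sup>2 * (- (22 * (r k)\<^sup>2)) \<le> (r j)\<^sup>2 * (- (U * V) / 2 + 3 * t j * V + 6 * t j * U + 6 * (t j)\<^sup>2)"
    by simp
  then have le: "- (22 * (r k)\<^sup>2) \<le> - (U * V) / 2 + 3 * t j * V + 6 * t j * U + 6 * (t j)\<^sup>2"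
    using T by (subst (asm) mult_le_cancel_left_pos) auto
  have UV: "(r j / 100) * (r k / 100) \<le> U * V"
    using U V T by (intro mult_mono) auto
  have "t j * V \<le> (r k / 10 ^ 7) * (2 * r k)" "t j * U \<le> (r k / 10 ^ 7) * (2 * r j)"
    "t j * t j \<le> (r k / 10 ^ 7) * (r k / 10 ^ 7)"
    using T U V by (intro mult_mono; simp add: U_def V_def)+
  then have "t j * V \<le> 2 * (r k * r k) / 10 ^ 7" "t j * U \<le> 2 * (r k * r j) / 10 ^ 7"
    "t j * t j \<le> r k * r k / 10 ^ 14"
    by simp_all
  moreover have "r k * r j / 10 ^ 4 \<le> U * V" using UV by (simp add: mult.commute)
  moreover have "- (22 * (r k * r k)) \<le> - (U * V) / 2 + 3 * (t j * V) + 6 * (t j * U) + 6 * (t j * t j)"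
    using le by (simp only: power2_eq_square mult.assoc)
  ultimately show False using rr by (intro nonpole_arith2)
qed

text \<open>The horizontal part of \<open>h k\<close> is at most r k / 50, so
  \<open>heis_norm_eq\<close> leaves almost all of (r k)^4 to the height.\<close>

lemma pole_snd:
  assumes "k \<in> I" "norm (fst (p k)) < r k / 100"
  shows "\<bar>snd (h k)\<bar> \<ge> 99/100 * (r k)\<^sup>2"
proof -
  define z where "z = norm (fst (h k))"
  have "norm (fst (h k)) \<le> norm (fst (h k) - fst (p k)) + norm (fst (p k))"
    using norm_triangle_ineq[of "fst (h k) - fst (p k)" "fst (p k)"] by simp
  then have z: "0 \<le> z" "z \<le> r k / 50"
    using fst_h_diff[OF assms(1)] assms(2) t_le[of k k] assms(1) r_pos[of k] by (auto simp: z_def)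
  have "z\<^sup>2 \<le> (r k / 50)\<^sup>2" using z by (intro power_mono) auto
  then have "z\<^sup>2 * (r k)\<^sup>2 \<le> (r k / 50)\<^sup>2 * (r k)\<^sup>2" by (intro mult_right_mono) auto
  moreover have "r k ^ 4 = z\<^sup>2 * (r k)\<^sup>2 + (snd (h k))\<^sup>2"
    using heis_norm_eq[of "h k"] norm_h[OF assms(1)] by (simp add: z_def)
  moreover have "(r k / 50)\<^sup>2 * (r k)\<^sup>2 = r k ^ 4 / 2500" "(99/100 * (r k)\<^sup>2)\<^sup>2 = 9801 / 10000 * r k ^ 4"
    by (simp_all add: power_divide power2_eq_square power4_eq_xxxx)
  moreover have "r k ^ 4 > 0" using r_pos[OF assms(1)] by simp
  ultimately have "(99/100 * (r k)\<^sup>2)\<^sup>2 \<le> (snd (h k))\<^sup>2" by linarith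
  then show ?thesis by (simp add: abs_le_square_iff[symmetric])
qed

text \<open>As \<sigma> is nearly - \<tau>' and both heights have the same sign, - 2 \<tau> \<sigma>
  makes the form at least (r j)^2 (r k)^2. In \<open>form_le\<close> only the thickness terms can be
  positive, which forces both bounds.\<close>

lemma pole_pair:
  assumes jk: "j \<in> I" "k \<in> I" "j < k"
    and aligned: "dist (sgn (fst (p j))) (sgn (fst (p k))) < 1/2"
    and fast: "r k \<le> r j / 10 ^ 6"
    and u: "norm (fst (p j)) < r j / 100" and v: "norm (fst (p k)) < r k / 100"
    and sign: "sgn (snd (h j)) = sgn (snd (h k))"
  shows "norm (fst (p k)) \<le> 12 * t j" and "(r k)\<^sup>2 \<le> 12 * t j * norm (fst (p j))"
proof -
  note T = tj_small[OF jk]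
  define w where "w = norm (fst (q j k))"
  define \<sigma> where "\<sigma> = snd (q j k)"
  define \<omega> where "\<omega> = symp (fst (q j k)) (fst (h j))"
  define \<tau> where "\<tau> = snd (h j)"
  define \<tau>' where "\<tau>' = snd (h k)"
  define U where "U = norm (fst (p j))"
  define V where "V = norm (fst (p k))"
  have UV: "U \<ge> 0" "V \<ge> 0" "V < r k / 100" using v by (auto simp: U_def V_def)
  have rr: "0 < r k * r j" "r k * r k \<le> r k * r j / 10 ^ 6"
    using T fast mult_left_mono[OF fast, of "r k"] by auto
  have w: "0 \<le> w" "w \<le> r k / 50"
    using fst_q_add[OF jk] norm_triangle_ineq4[of "fst (q j k) + fst (p k)" "fst (p k)"] UV(3) T
    unfolding w_def V_def by auto
  have \<omega>: "\<bar>\<omega>\<bar> \<le> 1 / 50 * (r k * r j)"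
    using abs_form_symp[OF jk, of "1/50"] w(2) by (simp add: w_def \<omega>_def mult.assoc)
  have \<tau>: "\<bar>\<tau>\<bar> \<le> (r j)\<^sup>2" "99/100 * (r j)\<^sup>2 \<le> \<bar>\<tau>\<bar>"
    using abs_snd_h pole_snd jk u by (auto simp: \<tau>_def)
  have \<tau>': "\<bar>\<tau>'\<bar> \<le> (r k)\<^sup>2" "99/100 * (r k)\<^sup>2 \<le> \<bar>\<tau>'\<bar>"
    using abs_snd_h pole_snd jk v by (auto simp: \<tau>'_def)
  have d: "\<bar>\<sigma> + \<tau>'\<bar> \<le> (r k)\<^sup>2 / 10 ^ 6"
    using snd_q_add[OF jk] by (simp add: \<sigma>_def \<tau>'_def)
  have \<sigma>: "\<bar>\<sigma>\<bar> \<le> 2 * (r k)\<^sup>2"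
  proof -
    have "(r k)\<^sup>2 / 10 ^ 6 \<le> (r k)\<^sup>2" by simp
    then show ?thesis using d \<tau>'(1) by linarith
  qed
  have prod: "(99/100 * (r j)\<^sup>2) * (99/100 * (r k)\<^sup>2) \<le> \<tau> * \<tau>'"
  proof -
    have "(99/100 * (r j)\<^sup>2) * (99/100 * (r k)\<^sup>2) \<le> \<bar>\<tau>\<bar> * \<bar>\<tau>'\<bar>"
      using \<tau> \<tau>' by (intro mult_mono) auto
    also have "\<dots> = \<tau> * \<tau>'"
      using sign unfolding \<tau>_def[symmetric] \<tau>'_def[symmetric] by (auto simp: abs_if sgn_if split: if_splits)
    finally show ?thesis .
  qed
  have "(r j)\<^sup>2 * w\<^sup>2 \<le> (r j)\<^sup>2 * (r k / 50)\<^sup>2"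
    using w T by (intro mult_left_mono power_mono) auto
  moreover have "(\<sigma> + \<omega> / 2)\<^sup>2 \<le> (1/50 * (r k * r j))\<^sup>2"
  proof -
    have "\<bar>\<sigma>\<bar> \<le> 2 * (r k * r j / 10 ^ 6)" using \<sigma> rr unfolding power2_eq_square by linarith
    then have "\<bar>\<sigma> + \<omega> / 2\<bar> \<le> 1/50 * (r k * r j)" using \<omega> rr(1) by (rule abs_add_half_le) simp
    from power_mono[OF this abs_ge_zero, of 2] show ?thesis unfolding power2_abs .
  qed
  moreover have "\<tau> * \<sigma> + \<tau> * \<tau>' \<le> (r j)\<^sup>2 * ((r k)\<^sup>2 / 10 ^ 6)"
  proof -
    have "\<bar>\<tau> * (\<sigma> + \<tau>')\<bar> \<le> (r j)\<^sup>2 * ((r k)\<^sup>2 / 10 ^ 6)"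
      unfolding abs_mult using \<tau> d by (intro mult_mono) auto
    from abs_le_D1[OF this] show ?thesis by (simp only: distrib_left)
  qed
  moreover have "0 \<le> (r j)\<^sup>2 * (r k)\<^sup>2" by simp
  ultimately have "(r j)\<^sup>2 * (r k)\<^sup>2 \<le> - ((r j)\<^sup>2 * w\<^sup>2) - (\<sigma> + \<omega> / 2)\<^sup>2 - 2 * \<tau> * \<sigma>"
    using prod pole_arith[of "(r j)\<^sup>2 * w\<^sup>2" "(r j)\<^sup>2 * (r k)\<^sup>2" "(\<sigma> + \<omega> / 2)\<^sup>2" "\<tau> * \<sigma>" "\<tau> * \<tau>'"]
    by (simp add: power_mult_distrib power_divide mult.commute mult.left_commute)
  also have "\<dots> \<le> (r j)\<^sup>2 * (- (U * V) / 2 + 3 * t j * V + 6 * t j * U + 6 * (t j)\<^sup>2)"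
    using form_le[OF jk aligned] form_eq[OF jk] unfolding U_def V_def w_def \<omega>_def \<sigma>_def \<tau>_def by simp
  finally have le: "(r k)\<^sup>2 \<le> - (U * V) / 2 + 3 * t j * V + 6 * t j * U + 6 * (t j)\<^sup>2"
    using T by (subst (asm) mult_le_cancel_left_pos) auto
  have le': "r k * r k \<le> - (U * V) / 2 + 3 * (t j * V) + 6 * (t j * U) + 6 * (t j * t j)"
    using le by (simp only: power2_eq_square mult.assoc)
  have W: "0 < r k * r k" using T by simp
  have "t j * t j \<le> (r k / 10 ^ 7) * (r k / 10 ^ 7)" "t j * r k \<le> (r k / 10 ^ 7) * r k"
    using T by (intro mult_mono; simp)+
  then have tt: "t j * t j \<le> r k * r k / 10 ^ 14" "t j * r k \<le> r k * r k / 10 ^ 7"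
    by simp_all
  show V: "V \<le> 12 * t j"
  proof (rule ccontr)
    assume "\<not> ?thesis"
    \<comment> \<open>If V > 12 t, then U \<ge> 0 bounds this product below by - 6 t r k, against
      \<open>pole_arith2\<close>.\<close>
    then have "(U - 6 * t j) * (V - 12 * t j) \<ge> (- 6 * t j) * (V - 12 * t j)"
      using UV by (intro mult_right_mono) auto
    moreover have "(- 6 * t j) * (V - 12 * t j) \<ge> (- 6 * t j) * r k"
      using UV T by (intro mult_left_mono_neg) auto
    moreover have "U * V - 12 * (t j * U) - 6 * (t j * V) + 72 * (t j * t j) < - 6 * (t j * r k)"
      by (rule pole_arith2[OF le' tt W])
    ultimately show False by (simp add: algebra_simps)
  qed
  \<comment> \<open>Now 3 t V + 6 t^2 is at most 42 t^2, negligible against (r k)^2, so the term 6 t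
    U has to carry the bound.\<close>
  have "U * V \<ge> 0" "t j * V \<le> 12 * (t j * t j)"
    using UV T mult_left_mono[OF V, of "t j"] by auto
  then have "r k * r k \<le> 12 * (t j * U)"
    by (intro pole_arith3[OF le' tt(1) _ _ W])
  then show "(r k)\<^sup>2 \<le> 12 * t j * U" by (simp add: power2_eq_square)
qed

end

lemma eq_of_dist_less:
  fixes x y :: real
  assumes "x \<in> {-1, 0, 1}" "y \<in> {-1, 0, 1}" "dist x y < 1/2"
  shows "x = y"
  using assms by (auto simp: dist_real_def)

lemma card_3_ordered:
  fixes T :: "'a::linorder set"
  assumes "card T = 3"
  obtains i j k where "i \<in> T" "j \<in> T" "k \<in> T" "i < j" "j < k"
proof -
  obtain x y z where T: "T = {x, y, z}" "x \<noteq> y" "y \<noteq> z" "x \<noteq> z"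
    using assms by (auto simp: card_3_iff)
  consider "x < y" "y < z" | "x < z" "z < y" | "y < x" "x < z" | "y < z" "z < x" | "z < x" "x < y" | "z < y" "y < x"
    using T by (metis linorder_less_linear)
  then show thesis using that T(1) by cases auto
qed

section \<open>Triples with rapidly decreasing radii\<close>

context near_spheres
begin

text \<open>The second component vanishes iff \<open>p j\<close> is far from the poles of its sphere, see
  \<open>pole_snd\<close>; otherwise it tells the two poles apart.\<close>

definition colour :: "nat \<Rightarrow> (complex ^ 'n) \<times> real" where
  "colour j = (sgn (fst (p j)), if norm (fst (p j)) \<ge> r j / 100 then 0 else sgn (snd (h j)))"

lemma colour_bounded: "colour j \<in> cball 0 2"
proof -
  have "norm (colour j) \<le> norm (fst (colour j)) + norm (snd (colour j))"
    using norm_Pair_le[of "fst (colour j)" "snd (colour j)"] by simp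
  moreover have "norm (fst (colour j)) \<le> 1" by (simp add: colour_def norm_sgn)
  moreover have "norm (snd (colour j)) \<le> 1" by (simp add: colour_def abs_sgn_eq)
  ultimately show ?thesis by simp
qed

text \<open>Away from the poles two centres suffice. Near a pole, the first pair makes
  \<open>p j\<close> horizontally at most 12 t i, and the second gives (r k)^2 \<le> 144 t i t j,
  although both thicknesses are at most r k / 10^7.\<close>

lemma no_fast_triple:
  assumes I: "i \<in> I" "j \<in> I" "k \<in> I" and ijk: "i < j" "j < k"
    and fast: "r j \<le> r i / 10 ^ 6" "r k \<le> r j / 10 ^ 6"
    and close: "dist (colour i) (colour j) < 1/2" "dist (colour j) (colour k) < 1/2"
  shows False
proof -
  define d where "d l = (if norm (fst (p l)) \<ge> r l / 100 then 0 else sgn (snd (h l)))" for l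
  have col: "colour l = (sgn (fst (p l)), d l)" for l by (simp add: colour_def d_def)
  have dir: "dist (sgn (fst (p i))) (sgn (fst (p j))) < 1/2" "dist (sgn (fst (p j))) (sgn (fst (p k))) < 1/2"
    using close dist_fst_le[of "colour i" "colour j"] dist_fst_le[of "colour j" "colour k"]
    by (auto simp: col)
  have "dist (d i) (d j) < 1/2" "dist (d j) (d k) < 1/2"
    using close dist_snd_le[of "colour i" "colour j"] dist_snd_le[of "colour j" "colour k"]
    by (auto simp: col)
  moreover have "d l \<in> {-1, 0, 1}" for l by (auto simp: d_def sgn_if)
  ultimately have d: "d i = d j" "d j = d k"
    by (intro eq_of_dist_less; simp)+
  have pole_iff: "d l = 0 \<longleftrightarrow> norm (fst (p l)) \<ge> r l / 100" if "l \<in> I" for l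
    using pole_snd[OF that] r_pos[OF that] by (auto simp: d_def sgn_zero_iff not_le)
  show False
  proof (cases "d i = 0")
    case True
    then show False
      using nonpole_contradiction[OF I(1,2) ijk(1) dir(1) fast(1)]
        pole_iff[OF I(1)] pole_iff[OF I(2)] d(1) by simp
  next
    case False
    then have pole: "norm (fst (p i)) < r i / 100" "norm (fst (p j)) < r j / 100" "norm (fst (p k)) < r k / 100"
      using pole_iff[OF I(1)] pole_iff[OF I(2)] pole_iff[OF I(3)] d by simp_all
    then have "sgn (snd (h i)) = sgn (snd (h j))" "sgn (snd (h j)) = sgn (snd (h k))"
      using d by (auto simp: d_def)
    then have U: "norm (fst (p j)) \<le> 12 * t i" and le: "(r k)\<^sup>2 \<le> 12 * t j * norm (fst (p j))"
      using pole_pair(1)[OF I(1,2) ijk(1) dir(1) fast(1) pole(1,2)]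
        pole_pair(2)[OF I(2,3) ijk(2) dir(2) fast(2) pole(2,3)] by auto
    have T: "t i \<le> r k / 10 ^ 7" "t j \<le> r k / 10 ^ 7" "0 < t i" "0 < t j" "0 < r k"
      using t_le[of i k] t_le[of j k] I ijk t_pos r_pos by auto
    have "12 * t j * norm (fst (p j)) \<le> 12 * (r k / 10 ^ 7) * (12 * (r k / 10 ^ 7))"
      using T U by (intro mult_mono) auto
    also have "\<dots> < (r k)\<^sup>2" using T by (simp add: power2_eq_square)
    finally show False using le by simp
  qed
qed

section \<open>Radii not much below the first one\<close>

text \<open>The dilate \<open>heis_dil (1 / \<rho>) (p j)\<close>, viewed in Euclidean space for the
  pigeonhole principle.\<close>

definition rescaled :: "real \<Rightarrow> nat \<Rightarrow> (complex ^ 'n) \<times> real" where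
  "rescaled \<rho> j = ((1 / \<rho>) *\<^sub>R fst (p j), snd (p j) / \<rho>\<^sup>2)"

text \<open>The inverse of \<open>p k\<close> is the quotient with \<open>p i\<close> times the
  inverse of \<open>p i\<close>; both gauges are at most 4 r i, and 16 = 2 (4 + 4).\<close>

lemma heis_norm_p_le_earlier:
  assumes "i \<in> I" "k \<in> I" "i \<le> k"
  shows "heis_norm (p k) \<le> 16 * r i"
proof (cases "i = k")
  case True
  then show ?thesis using heis_norm_p_le[OF assms(1)] r_pos[OF assms(1)] by simp
next
  case False
  then have ik: "i < k" using assms(3) by simp
  have "heis_inv (p k) = heis_mult (heis_mult (a i k) (b i k)) (heis_inv (p i))"
    unfolding quotient_eq[OF assms(1,2) ik, symmetric]
    by (simp add: heis_mult_eq heis_inv_def symp_minus symp_diff)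
  then have "heis_norm (p k) \<le> 2 * (heis_norm (heis_mult (a i k) (b i k)) + heis_norm (p i))"
    using heis_norm_mult_le[of "heis_mult (a i k) (b i k)" "heis_inv (p i)"] heis_norm_inv[of "p k"] by simp
  moreover have "heis_norm (heis_mult (a i k) (b i k)) \<le> 4 * r i"
    using heis_norm_mult_le[of "a i k" "b i k"] norm_a[OF assms(1,2) ik] norm_b[OF assms(1,2) ik]
      t_le[of i i] t_pos[of i] assms(1) by simp
  ultimately show ?thesis using heis_norm_p_le[OF assms(1)] by simp
qed

lemma rescaled_bounded:
  assumes "i \<in> I" "k \<in> I" "i \<le> k"
  shows "rescaled (r i) k \<in> cball 0 272"
proof -
  have r: "r i > 0" using r_pos assms by simp
  note N = heis_norm_p_le_earlier[OF assms]
  have 1: "norm (fst (p k)) \<le> 16 * r i"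
    using N norm_fst_le_heis_norm order_trans by blast
  have "(heis_norm (p k))\<^sup>2 \<le> (16 * r i)\<^sup>2" using N heis_norm_nonneg by (intro power_mono)
  then have 2: "\<bar>snd (p k)\<bar> \<le> 256 * (r i)\<^sup>2"
    using abs_snd_le_heis_norm[of "p k"] by (simp add: power_mult_distrib)
  have "norm (rescaled (r i) k) \<le> norm (fst (p k)) / r i + \<bar>snd (p k)\<bar> / (r i)\<^sup>2"
    using r norm_Pair_le[of "(1 / r i) *\<^sub>R fst (p k)" "snd (p k) / (r i)\<^sup>2"]
    by (simp add: rescaled_def)
  \<comment> \<open>The height scales quadratically: 256 = 16^2.\<close>
  also have "\<dots> \<le> 16 + 256"
    using 1 2 r by (intro add_mono) (auto simp: pos_divide_le_eq)
  finally show ?thesis by simp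
qed

text \<open>Close rescaled points have a quotient of gauge at most 2 \<rho> / 10^7, but this
  quotient lies near the sphere of radius r i \<ge> \<rho> / 10^6 about the identity.\<close>

lemma no_close_slow_pair:
  assumes I: "m \<in> I" "i \<in> I" "k \<in> I" and mik: "m \<le> i" "i < k"
    and slow: "r i \<ge> r m / 10 ^ 6"
    and close: "dist (rescaled (r m) i) (rescaled (r m) k) < 1 / 10 ^ 16"
  shows False
proof -
  define \<rho> where "\<rho> = r m"
  have \<rho>: "\<rho> > 0" using r_pos I by (simp add: \<rho>_def)
  define D where "D = heis_mult (heis_inv (p k)) (p i)"
  have z: "norm (fst (p i) - fst (p k)) \<le> \<rho> / 10 ^ 16"
  proof -
    have "dist ((1 / \<rho>) *\<^sub>R fst (p i)) ((1 / \<rho>) *\<^sub>R fst (p k)) \<le> 1 / 10 ^ 16"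
      using close dist_fst_le[of "rescaled (r m) i" "rescaled (r m) k"] by (simp add: rescaled_def \<rho>_def)
    then have "norm ((1 / \<rho>) *\<^sub>R (fst (p i) - fst (p k))) \<le> 1 / 10 ^ 16"
      by (simp only: dist_norm scaleR_diff_right)
    then show ?thesis using \<rho> by (simp add: pos_divide_le_eq)
  qed
  have \<tau>: "\<bar>snd (p i) - snd (p k)\<bar> \<le> \<rho>\<^sup>2 / 10 ^ 16"
  proof -
    have "dist (snd (p i) / \<rho>\<^sup>2) (snd (p k) / \<rho>\<^sup>2) \<le> 1 / 10 ^ 16"
      using close dist_snd_le[of "rescaled (r m) i" "rescaled (r m) k"] by (simp add: rescaled_def \<rho>_def)
    then have "\<bar>(snd (p i) - snd (p k)) / \<rho>\<^sup>2\<bar> \<le> 1 / 10 ^ 16"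
      by (simp only: dist_real_def diff_divide_distrib)
    then show ?thesis using \<rho> by (simp add: pos_divide_le_eq)
  qed
  have k: "norm (fst (p k)) \<le> 16 * \<rho>"
    using heis_norm_p_le_earlier[OF I(1,3)] mik norm_fst_le_heis_norm[of "p k"] by (simp add: \<rho>_def)
  have "heis_norm D \<le> 2 * (\<rho> / 10 ^ 7)"
  proof (rule heis_norm_le)
    show "norm (fst D) \<le> \<rho> / 10 ^ 7" using z \<rho> by (simp add: D_def)
    have "\<bar>symp (fst (p k)) (fst (p i) - fst (p k))\<bar> \<le> 16 * \<rho> * (\<rho> / 10 ^ 16)"
      using abs_symp_le[of "fst (p k)" "fst (p i) - fst (p k)"] mult_mono[OF k z] \<rho> by simp
    \<comment> \<open>The form is alternating, so \<open>fst (p i)\<close> may replace the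
      difference.\<close>
    then have s: "\<bar>symp (fst (p k)) (fst (p i)) / 2\<bar> \<le> 8 * (\<rho>\<^sup>2 / 10 ^ 16)"
      by (simp add: symp_diff power2_eq_square)
    have "snd D = (snd (p i) - snd (p k)) - symp (fst (p k)) (fst (p i)) / 2"
      by (simp add: D_def snd_heis_mult symp_minus)
    then have "\<bar>snd D\<bar> \<le> \<bar>snd (p i) - snd (p k)\<bar> + \<bar>symp (fst (p k)) (fst (p i)) / 2\<bar>"
      by (simp only: abs_triangle_ineq4)
    also have "\<dots> \<le> \<rho>\<^sup>2 / 10 ^ 16 + 8 * (\<rho>\<^sup>2 / 10 ^ 16)"
      using \<tau> s by (rule add_mono)
    \<comment> \<open>Closeness 1 / 10^16 is chosen for this: 9 / 10^16 \<le> 1 / 10^14.\<close>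
    also have "\<dots> \<le> (\<rho> / 10 ^ 7)\<^sup>2" by (simp add: power_divide)
    finally show "\<bar>snd D\<bar> \<le> (\<rho> / 10 ^ 7)\<^sup>2" .
  qed
  moreover have "r i \<le> 2 * (t i + heis_norm D)"
  proof -
    have "b i k = heis_mult (heis_inv (a i k)) D"
      using quotient_eq[OF I(2,3) mik(2)] by (simp add: D_def)
    then show ?thesis
      using heis_norm_mult_le[of "heis_inv (a i k)" D] norm_a[OF I(2,3) mik(2)] norm_b[OF I(2,3) mik(2)]
      by simp
  qed
  ultimately show False
    using slow t_le[of i i] I \<rho> by (simp add: \<rho>_def)
qed

end

section \<open>Ramsey argument\<close>

text \<open>Join two indices when the later radius is smaller by a factor 10^6. Large cliques
  contradict \<open>no_fast_triple\<close>, large independent sets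
  \<open>no_close_slow_pair\<close>.\<close>

lemma near_spheres_bounded:
  shows "\<exists>\<kappa>\<ge>1. \<forall>I t r (p :: nat \<Rightarrow> 'n::finite heis) g h a b.
    finite I \<longrightarrow> \<kappa> \<le> card I \<longrightarrow> \<not> near_spheres I t r p g h a b"
proof -
  have "\<exists>M. \<forall>S (f :: nat \<Rightarrow> (complex ^ 'n) \<times> real). finite S \<longrightarrow> M \<le> card S \<longrightarrow> f ` S \<subseteq> cball 0 2 \<longrightarrow>
      (\<exists>T\<subseteq>S. card T = 3 \<and> (\<forall>x\<in>T. \<forall>y\<in>T. dist (f x) (f y) < 1/2))"
    by (rule bounded_pigeonhole) auto
  then obtain M1 where M1: "\<forall>S (f :: nat \<Rightarrow> (complex ^ 'n) \<times> real). finite S \<longrightarrow> M1 \<le> card S \<longrightarrow> f ` S \<subseteq> cball 0 2 \<longrightarrow>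
      (\<exists>T\<subseteq>S. card T = 3 \<and> (\<forall>x\<in>T. \<forall>y\<in>T. dist (f x) (f y) < 1/2))" ..
  have "\<exists>M. \<forall>S (f :: nat \<Rightarrow> (complex ^ 'n) \<times> real). finite S \<longrightarrow> M \<le> card S \<longrightarrow> f ` S \<subseteq> cball 0 272 \<longrightarrow>
      (\<exists>T\<subseteq>S. card T = 2 \<and> (\<forall>x\<in>T. \<forall>y\<in>T. dist (f x) (f y) < 1 / 10 ^ 16))"
    by (rule bounded_pigeonhole) auto
  then obtain M2 where M2: "\<forall>S (f :: nat \<Rightarrow> (complex ^ 'n) \<times> real). finite S \<longrightarrow> M2 \<le> card S \<longrightarrow> f ` S \<subseteq> cball 0 272 \<longrightarrow>
      (\<exists>T\<subseteq>S. card T = 2 \<and> (\<forall>x\<in>T. \<forall>y\<in>T. dist (f x) (f y) < 1 / 10 ^ 16))" ..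
  obtain \<kappa> where \<kappa>: "\<kappa> \<ge> 1" "\<And>(V :: nat set) E. \<lbrakk>finite V; \<kappa> \<le> card V\<rbrakk> \<Longrightarrow>
      \<exists>S\<subseteq>V. card S = M1 \<and> clique S E \<or> card S = M2 + 1 \<and> indep S E"
    \<comment> \<open>\<open>M2 + 1\<close> makes the independent set nonempty, so that its minimum
      exists.\<close>
    using ramsey2[of M1 "M2 + 1"] by metis
  show ?thesis
  proof (intro exI[of _ \<kappa>] conjI allI impI notI)
    fix I t r and p g h :: "nat \<Rightarrow> 'n heis" and a b
    assume I: "finite I" "\<kappa> \<le> card I" and "near_spheres I t r p g h a b"
    then interpret near_spheres I t r p g h a b by simp
    define E where "E = {{i, j} |i j. i < j \<and> r j \<le> r i / 10 ^ 6}"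
    have E_iff: "{i, j} \<in> E \<longleftrightarrow> r j \<le> r i / 10 ^ 6" if "i < j" for i j
      using that by (auto simp: E_def doubleton_eq_iff)
    obtain S where S: "S \<subseteq> I" "card S = M1 \<and> clique S E \<or> card S = M2 + 1 \<and> indep S E"
      using \<kappa>(2)[OF I] by blast
    have fin: "finite S" using S(1) I(1) finite_subset by blast
    from S(2) show False
    proof
      assume S2: "card S = M1 \<and> clique S E"
      have "colour ` S \<subseteq> cball 0 2" using colour_bounded by blast
      then have "\<exists>T\<subseteq>S. card T = 3 \<and> (\<forall>x\<in>T. \<forall>y\<in>T. dist (colour x) (colour y) < 1/2)"
        using S2 by (intro M1[rule_format] fin) simp_all
      then obtain T where T: "T \<subseteq> S" "card T = 3" "\<And>x y. \<lbrakk>x \<in> T; y \<in> T\<rbrakk> \<Longrightarrow> dist (colour x) (colour y) < 1/2"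
        by blast
      obtain i j k where ijk: "i \<in> T" "j \<in> T" "k \<in> T" "i < j" "j < k"
        using T(2) by (rule card_3_ordered)
      have mem: "i \<in> S" "j \<in> S" "k \<in> S" using T(1) ijk by auto
      then have "{i, j} \<in> E" "{j, k} \<in> E" using S2 ijk by (auto simp: clique_def)
      then show False
        using no_fast_triple[of i j k] mem S(1) ijk T(3) E_iff by auto
    next
      assume S2: "card S = M2 + 1 \<and> indep S E"
      define m where "m = Min S"
      have "S \<noteq> {}" using S2 by auto
      then have m: "m \<in> S" "\<And>x. x \<in> S \<Longrightarrow> m \<le> x" using fin by (auto simp: m_def)
      have slow: "r i \<ge> r m / 10 ^ 6" if "i \<in> S" for i
      proof (cases "i = m")
        case True
        then show ?thesis using r_pos[of m] m S(1) by auto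
      next
        case False
        then have "m < i" using m(2)[OF that] by simp
        then have "{m, i} \<notin> E" using S2 that m(1) by (auto simp: indep_def)
        then show ?thesis using E_iff[OF \<open>m < i\<close>] by simp
      qed
      have "rescaled (r m) ` S \<subseteq> cball 0 272"
        using rescaled_bounded m S(1) by blast
      then have "\<exists>T\<subseteq>S. card T = 2 \<and>
          (\<forall>x\<in>T. \<forall>y\<in>T. dist (rescaled (r m) x) (rescaled (r m) y) < 1 / 10 ^ 16)"
        using S2 by (intro M2[rule_format] fin) simp_all
      then obtain T where T: "T \<subseteq> S" "card T = 2"
          "\<And>x y. \<lbrakk>x \<in> T; y \<in> T\<rbrakk> \<Longrightarrow> dist (rescaled (r m) x) (rescaled (r m) y) < 1 / 10 ^ 16"
        by blast
      then obtain i k where ik: "i \<in> T" "k \<in> T" "i < k"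
        by (metis card_2_iff insertCI linorder_neqE_nat)
      then show False
        using no_close_slow_pair[of m i k] T m slow S(1) by blast
    qed
  qed (rule \<kappa>(1))
qed

section \<open>From thickened spheres to a configuration\<close>

lemma product_ge_factor:
  fixes t :: "nat \<Rightarrow> real"
  assumes "\<forall>i\<in>{1..\<kappa>}. t i \<ge> 1" "1 \<le> j" "j \<le> i" "i \<le> \<kappa>"
  shows "t j \<le> (\<Prod>l=1..i. t l)"
proof -
  have "(\<Prod>l=1..i. t l) = t j * (\<Prod>l\<in>{1..i} - {j}. t l)"
    using assms by (intro prod.remove) auto
  moreover have "1 \<le> (\<Prod>l\<in>{1..i} - {j}. t l)" using assms by (intro prod_ge_1) auto
  moreover have "1 \<le> t j" using assms by auto
  ultimately show ?thesis by (metis mult_left_mono mult.right_neutral order_trans zero_le_one)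
qed

theorem theorem14:
  shows "\<exists>\<kappa>::nat. \<exists>R::real. R > 1 \<and>
    (\<forall>(t::nat \<Rightarrow> real) (r::nat \<Rightarrow> real) (x::nat \<Rightarrow> 'n::finite heis).
      (\<forall>i\<in>{1..\<kappa>}. t i \<ge> 1) \<longrightarrow>
      (\<forall>i\<in>{1..\<kappa>}. r i \<ge> (\<Prod>j=1..i. t j) * R) \<longrightarrow>
      (\<forall>i\<in>{1..\<kappa>}. \<forall>j\<in>{1..<i}. x i \<in> thick_bdry (t j) (r j) (x j)) \<longrightarrow>
      (\<Inter>i\<in>{1..\<kappa>}. thick_bdry (t i) (r i) (x i)) = {})"
proof -
  obtain \<kappa> where \<kappa>: "\<kappa> \<ge> 1" "\<And>I t r p g h a b. \<lbrakk>finite I; \<kappa> \<le> card I\<rbrakk> \<Longrightarrow>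
      \<not> near_spheres I t r (p :: nat \<Rightarrow> 'n heis) g h a b"
    using near_spheres_bounded by blast
  show ?thesis
  \<comment> \<open>The factor 10^7 comes from \<open>t_le\<close>, the 2 from doubling the
    thickness to gain a strict inequality.\<close>
  proof (rule exI[of _ \<kappa>], rule exI[of _ "2 * 10 ^ 7"], intro conjI allI impI)
    fix t r :: "nat \<Rightarrow> real" and x :: "nat \<Rightarrow> 'n heis"
    assume t: "\<forall>i\<in>{1..\<kappa>}. t i \<ge> 1"
      and r: "\<forall>i\<in>{1..\<kappa>}. r i \<ge> (\<Prod>j=1..i. t j) * (2 * 10 ^ 7)"
      and x: "\<forall>i\<in>{1..\<kappa>}. \<forall>j\<in>{1..<i}. x i \<in> thick_bdry (t j) (r j) (x j)"
    have tr: "10 ^ 7 * (2 * t j) \<le> r k" if "j \<in> {1..\<kappa>}" "k \<in> {1..\<kappa>}" "j \<le> k" for j k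
    proof -
      have "t j * (2 * 10 ^ 7) \<le> (\<Prod>j=1..k. t j) * (2 * 10 ^ 7)"
        using product_ge_factor[OF t] that by (intro mult_right_mono) auto
      then show ?thesis using r that(2) by force
    qed
    have t2: "0 < 2 * t j" "t j < 2 * t j" if "j \<in> {1..\<kappa>}" for j
      using t that by force+
    have r0: "0 \<le> r j" if "j \<in> {1..\<kappa>}" for j
      using tr[OF that that] t2[OF that] by simp
    show "(\<Inter>i\<in>{1..\<kappa>}. thick_bdry (t i) (r i) (x i)) = {}"
    proof (rule ccontr)
      assume "\<not> ?thesis"
      then obtain y where y: "\<And>i. i \<in> {1..\<kappa>} \<Longrightarrow> y \<in> thick_bdry (t i) (r i) (x i)"
        by blast
      define p where "p j = heis_mult y (heis_inv (x j))" for j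
      have "\<exists>g h. p j = heis_mult g h \<and> heis_norm g \<le> 2 * t j \<and> heis_norm h = r j"
        if "j \<in> {1..\<kappa>}" for j
        unfolding p_def using y r0 t2 that by (blast elim: thick_bdryE)
      then obtain g h where gh: "\<And>j. j \<in> {1..\<kappa>} \<Longrightarrow>
          p j = heis_mult (g j) (h j) \<and> heis_norm (g j) \<le> 2 * t j \<and> heis_norm (h j) = r j"
        by metis
      have "\<exists>a b. heis_mult (heis_inv (p k)) (p j) = heis_mult a b \<and>
          heis_norm a \<le> 2 * t j \<and> heis_norm b = r j"
        if "j \<in> {1..\<kappa>}" "k \<in> {1..\<kappa>}" "j < k" for j k
      proof -
        \<comment> \<open>The point y cancels, so membership of \<open>x k\<close> in the earlier
          thickened spheres supplies a and b.\<close>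
        have "heis_mult (heis_inv (p k)) (p j) = heis_mult (x k) (heis_inv (x j))"
          by (simp add: p_def heis_inv_mult heis_mult_assoc)
        moreover have "x k \<in> thick_bdry (t j) (r j) (x j)" using x that by auto
        ultimately show ?thesis using r0 t2 that by (metis thick_bdryE)
      qed
      then obtain a b where ab: "\<And>j k. \<lbrakk>j \<in> {1..\<kappa>}; k \<in> {1..\<kappa>}; j < k\<rbrakk> \<Longrightarrow>
          heis_mult (heis_inv (p k)) (p j) = heis_mult (a j k) (b j k) \<and>
          heis_norm (a j k) \<le> 2 * t j \<and> heis_norm (b j k) = r j"
        by metis
      have "near_spheres {1..\<kappa>} (\<lambda>j. 2 * t j) r p g h a b"
        by unfold_locales (use t2 tr gh ab in blast)+
      then show False using \<kappa>(2)[of "{1..\<kappa>}"] by auto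
    qed
  qed simp
qed

end
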